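(* Let $\hat G_\alpha$, $|\alpha|\ge 0$, be the coefficients in $DG(P(\sigma))=\sum_{|\alpha|\ge0}\hat G_\alpha\sigma^\alpha$. Then the expansions $\mathcal{W}(\sigma)=\sum_{|\alpha|\ge 0}\mathcal{W}_\alpha\sigma^\alpha$ and $\mathcal{A}(\sigma)=\sum_{|\alpha|\ge 0}\mathcal{A}_\alpha\sigma^\alpha$ satisfy $$DG(P(\sigma))\,\mathcal{W}(\sigma) = D\mathcal{W}(\sigma)\,\Omega^{\mathrm{s}}\sigma+\mathcal{W}(\sigma)\mathcal{A}(\sigma)$$ at each order in $\sigma$ (that is, $(\hat G*\mathcal{W})_\alpha=(\alpha_1\mu_1+\dots+\alpha_m\mu_m)\mathcal{W}_\alpha+(\mathcal{W}*\mathcal{A})_\alpha$ for every $\alpha\in\mathbb{N}^m$) if $\mathcal{A}_0=\Omega$, $\mathcal{W}_0=[\hat V_1|\dots|\hat V_n]$, and $\mathcal{W}_\alpha$, $\mathcal{A}_\alpha$ for $|\alpha|\ge1$ are defined (recursively in $|\alpha|$) as follows. Let $$\mathcal{S}_\alpha=\hat G_\alpha\mathcal{W}_0+(\hat G\,\hat*\,\mathcal{W})_\alpha-(\mathcal{W}\,\hat*\,\mathcal{A})_\alpha,$$ set $\mathcal{W}_\alpha=\mathcal{W}_0\tilde{\mathcal{W}}_\alpha$ and $\mathcal{S}_\alpha=\mathcal{W}_0\tilde{\mathcal{S}}_\alpha$, and denote the entries in row $i$ and column $j$ of $\tilde{\mathcal{S}}_\alpha,\tilde{\mathcal{W}}_\alpha,\mathcal{A}_\alpha$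 by $\tilde s^{i,j}_\alpha,\tilde w^{i,j}_\alpha,a^{i,j}_\alpha$. Then define $$\tilde w^{i,j}_\alpha=\frac{\tilde s^{i,j}_\alpha}{\alpha_1\mu_1+\dots+\alpha_m\mu_m+\mu_j-\mu_i},\qquad a^{i,j}_\alpha=0,\qquad |\alpha|\ge1,\ \alpha\notin\mathrm{Res}_{i,j},$$ and $$\tilde w^{i,j}_\alpha=0,\qquad a^{i,j}_\alpha=\tilde s^{i,j}_\alpha,\qquad |\alpha|\ge1,\ \alpha\in\mathrm{Res}_{i,j}.$$ Moreover, $a^{i,j}_\alpha=0$ for all $i>j$, and $a^{i,j}_\alpha=0$ whenever $|\alpha|>\max\{|\alpha'|:\alpha'\in\mathrm{Res}_{i,j}\}$ (with the maximum of the empty set taken to be $0$).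
   Context: $G:\mathbb{R}^n\to\mathbb{R}^n$ is a real analytic vector field with a hyperbolic equilibrium $U_*$ such that $DG(U_* )$ is diagonalizable with real eigenvalues $\mu_1<\dots<\mu_m<0<\mu_{m+1}<\dots<\mu_n$ and corresponding eigenvectors $\hat V_1,\dots,\hat V_n$. $\Omega^{\mathrm{s}}=\mathrm{diag}(\mu_1,\dots,\mu_m)$, $\Omega=\mathrm{diag}(\mu_1,\dots,\mu_n)$. $P$ is an analytic parameterization of the local stable manifold of $U_*$, defined on $B^m_\delta(0)=[-\delta,\delta]^m$, with $P(0)=U_*$, $DP(0)=[\hat V_1|\cdots|\hat V_m]$ and $\Phi(x;P(\sigma))=P(e^{\Omega^{\mathrm{s}}x}\sigma)$ for $x\ge0$, where $\Phi$ is the flow of $U'=G(U)$; thus $\hat G_0=DG(U_* )$. Multi-indices: $\alpha\in\mathbb{N}^m$ with $\mathbb{N}=\{0,1,2,\dots\}$, $|\alpha|=\alpha_1+\dots+\alpha_m$, $\sigma^\alpha=\sigma_1^{\alpha_1}\cdots\sigma_m^{\alpha_m}$; $\beta\le\alpha$ means $\beta_k\le\alpha_k$ for all $k$. All $\hat G_\alpha,\mathcal{W}_\alpha,\mathcal{A}_\alpha$ are real $n\times n$ matrices. The Cauchy product is $(b*\tilde b)_\alpha=\sum_{\beta\le\alpha}b_{\alpha-\beta}\tilde b_\beta$ (matrix multiplication), and $(b\,\hat*\,\tilde b)_\alpha=\sum_{\beta\le\alpha,\ \beta\ne0,\ \beta\neq\alpha}b_{\alpha-\beta}\tilde b_\beta$,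 so for $\alpha\neq0$, $(b*\tilde b)_\alpha=b_0\tilde b_\alpha+b_\alpha\tilde b_0+(b\,\hat*\,\tilde b)_\alpha$. $\mathrm{Res}_{i,j}=\{\alpha\in\mathbb{N}^m:\ |\alpha|\ge1,\ \alpha_1\mu_1+\dots+\alpha_m\mu_m+\mu_j-\mu_i=0\}$. $D\mathcal{W}(\sigma)\Omega^{\mathrm{s}}\sigma$ is the derivative of $\mathcal{W}$ in direction $\Omega^{\mathrm{s}}\sigma$. *)

theory Defs
  imports "HOL-Analysis.Analysis"
begin

section \<open>Multi-indices and Cauchy products\<close>

text \<open>
  A multi-index is an element of \<^typ>\<open>nat^'m\<close>. The library order on this type is componentwise, and
  so is subtraction, which is the genuine one in the sums below since there \<open>\<beta> \<le> \<alpha>\<close>.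
\<close>

definition mi_order :: "nat^'m \<Rightarrow> nat" where
  "mi_order \<alpha> = (\<Sum>k\<in>UNIV. \<alpha> $ k)"

definition mi_power :: "real^'m \<Rightarrow> nat^'m \<Rightarrow> real" where
  "mi_power \<sigma> \<alpha> = (\<Prod>k\<in>UNIV. (\<sigma> $ k) ^ (\<alpha> $ k))"

definition mi_dot :: "nat^'m \<Rightarrow> ('m \<Rightarrow> real) \<Rightarrow> real" where
  "mi_dot \<alpha> \<nu> = (\<Sum>k\<in>UNIV. real (\<alpha> $ k) * \<nu> k)"

definition cauchy_prod ::
  "(nat^'m \<Rightarrow> real^'n^'n) \<Rightarrow> (nat^'m \<Rightarrow> real^'n^'n) \<Rightarrow> nat^'m \<Rightarrow> real^'n^'n" where
  "cauchy_prod b c \<alpha> = (\<Sum>\<beta> | \<beta> \<le> \<alpha>. b (\<alpha> - \<beta>) ** c \<beta>)"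

definition cauchy_prod_hat ::
  "(nat^'m \<Rightarrow> real^'n^'n) \<Rightarrow> (nat^'m \<Rightarrow> real^'n^'n) \<Rightarrow> nat^'m \<Rightarrow> real^'n^'n" where
  "cauchy_prod_hat b c \<alpha> = (\<Sum>\<beta> | \<beta> \<le> \<alpha> \<and> \<beta> \<noteq> 0 \<and> \<beta> \<noteq> \<alpha>. b (\<alpha> - \<beta>) ** c \<beta>)"

text \<open>The index sets of these sums are finite, so the sums have no default value.\<close>

lemma finite_mi_le: "finite {\<beta>. \<beta> \<le> (\<alpha> :: nat^'m)}"
proof -
  have "{\<beta>. \<beta> \<le> \<alpha>} \<subseteq> vec_lambda ` (PiE UNIV (\<lambda>k. {..\<alpha> $ k}))"
  proof
    fix \<beta> assume "\<beta> \<in> {\<beta>. \<beta> \<le> \<alpha>}"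
    then have "vec_nth \<beta> \<in> PiE UNIV (\<lambda>k. {..\<alpha> $ k})"
      by (auto simp: less_eq_vec_def)
    then show "\<beta> \<in> vec_lambda ` (PiE UNIV (\<lambda>k. {..\<alpha> $ k}))"
      by (metis image_eqI vec_nth_inverse)
  qed
  then show ?thesis
    by (rule finite_subset) (intro finite_imageI finite_PiE, auto)
qed

section \<open>Matrices\<close>

definition diag_matrix :: "('n \<Rightarrow> real) \<Rightarrow> real^'n^'n" where
  "diag_matrix d = (\<chi> i j. if i = j then d i else 0)"

definition matrix_of_columns :: "('k \<Rightarrow> real^'n) \<Rightarrow> real^'k^'n" where
  "matrix_of_columns v = (\<chi> i j. v j $ i)"

section \<open>Real analytic maps\<close>

text \<open>
  For non-open \<open>S\<close>, analyticity is understood relative to \<open>S\<close>: near each point of \<open>S\<close>, the map is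
  given on \<open>S\<close> by a convergent power series.
\<close>

definition real_analytic_on :: "(real^'m \<Rightarrow> real^'n) \<Rightarrow> (real^'m) set \<Rightarrow> bool" where
  "real_analytic_on f S \<longleftrightarrow>
    (\<forall>x\<in>S. \<exists>c :: nat^'m \<Rightarrow> real^'n. \<exists>r>0. \<forall>y\<in>S. dist x y < r \<longrightarrow>
      ((\<lambda>\<alpha>. mi_power (y - x) \<alpha> *\<^sub>R c \<alpha>) has_sum f y) UNIV)"

section \<open>Flows, hyperbolic equilibria and local stable manifolds\<close>

definition ivp_solution :: "(real^'n \<Rightarrow> real^'n) \<Rightarrow> real^'n \<Rightarrow> real \<Rightarrow> (real \<Rightarrow> real^'n) \<Rightarrow> bool" where
  "ivp_solution G u0 x U \<longleftrightarrow> U 0 = u0 \<and>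
    (\<forall>t \<in> closed_segment 0 x. (U has_vector_derivative G (U t)) (at t within closed_segment 0 x))"

text \<open>
  The flow \<open>\<Phi>(x; u0)\<close> of \<open>U' = G(U)\<close> is in general only partially defined; its value is unique for
  locally Lipschitz \<open>G\<close>. The value of \<open>flow\<close> is meaningful only under \<open>flow_defined\<close>.
\<close>

definition flow_defined :: "(real^'n \<Rightarrow> real^'n) \<Rightarrow> real \<Rightarrow> real^'n \<Rightarrow> bool" where
  "flow_defined G x u0 \<longleftrightarrow> (\<exists>U. ivp_solution G u0 x U)"

definition flow :: "(real^'n \<Rightarrow> real^'n) \<Rightarrow> real \<Rightarrow> real^'n \<Rightarrow> real^'n" where
  "flow G x u0 = (THE v. \<exists>U. ivp_solution G u0 x U \<and> U x = v)"

definition hyperbolic_equilibrium :: "(real^'n \<Rightarrow> real^'n) \<Rightarrow> real^'n \<Rightarrow> bool" where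
  "hyperbolic_equilibrium G u \<longleftrightarrow> G u = 0 \<and>
    (\<forall>(z::complex) (v::complex^'n).
      v \<noteq> 0 \<and> map_matrix complex_of_real (jacobian G (at u)) *v v = z *s v \<longrightarrow> Re z \<noteq> 0)"

definition local_stable_manifold :: "(real^'n \<Rightarrow> real^'n) \<Rightarrow> real^'n \<Rightarrow> (real^'n) set \<Rightarrow> bool" where
  "local_stable_manifold G u M \<longleftrightarrow>
    (\<exists>N. u \<in> interior N \<and>
      M = {v \<in> N. (\<forall>x\<ge>0. flow_defined G x v \<and> flow G x v \<in> N) \<and>
                 ((\<lambda>x. flow G x v) \<longlongrightarrow> u) at_top})"

section \<open>Resonances\<close>

text \<open>
  The coordinates of \<open>\<real>\<^sup>n\<close> and of the stable subspace are indexed by types \<open>'n\<close> and \<open>'m\<close>; the map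
  \<open>\<iota>\<close> embeds the second index set into the first, so that \<open>\<mu> \<circ> \<iota>\<close> lists the stable eigenvalues.
\<close>

definition Res :: "('n \<Rightarrow> real) \<Rightarrow> ('m \<Rightarrow> 'n) \<Rightarrow> 'n \<Rightarrow> 'n \<Rightarrow> (nat^'m) set" where
  "Res \<mu> \<iota> i j = {\<alpha>. mi_order \<alpha> \<ge> 1 \<and> mi_dot \<alpha> (\<mu> \<circ> \<iota>) + \<mu> j - \<mu> i = 0}"

text \<open>
  The maximal order is only used for finite sets (\<open>Res \<mu> \<iota> i j\<close> is finite if \<open>\<mu> \<circ> \<iota>\<close> is negative).
\<close>

definition max_order :: "(nat^'m) set \<Rightarrow> nat" where
  "max_order R = (if R = {} then 0 else Max (mi_order ` R))"

end

theory Submission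
  imports Defs
begin

text \<open>
  Since \<open>J = DG(U\<^sub>*)\<close>, the zeroth coefficient of \<open>DG \<circ> P\<close>, satisfies \<open>J W\<^sub>0 = W\<^sub>0 \<Omega>\<close>, the equation at
  order \<open>\<alpha> \<noteq> 0\<close> becomes, after factoring out \<open>W\<^sub>0\<close> on the left, the system of scalar equations
  \<open>s\<^sub>i\<^sub>j = (\<langle>\<alpha>, \<mu>\<rangle> + \<mu>\<^sub>j - \<mu>\<^sub>i) w\<^sub>i\<^sub>j + a\<^sub>i\<^sub>j\<close>, which the given choice of \<open>w\<close> and \<open>a\<close> solves. As the stable
  eigenvalues are negative, a resonance forces \<open>\<mu>\<^sub>i \<le> \<mu>\<^sub>j\<close> and bounds \<open>\<alpha>\<close>, which gives the two
  vanishing statements.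
\<close>

lemma mi_order_ge_1_iff: "mi_order \<alpha> \<ge> 1 \<longleftrightarrow> \<alpha> \<noteq> 0"
  by (simp add: mi_order_def vec_eq_iff Suc_le_eq neq0_conv[symmetric] del: neq0_conv)

lemma mi_power_zero: "mi_power 0 \<alpha> = (if \<alpha> = 0 then 1 else 0)"
  by (auto simp: mi_power_def vec_eq_iff)

lemma mi_dot_zero: "mi_dot 0 \<nu> = 0"
  by (simp add: mi_dot_def)

lemma mi_dot_nonpos:
  assumes "\<And>k. \<nu> k \<le> 0"
  shows "mi_dot \<alpha> \<nu> \<le> 0"
  unfolding mi_dot_def using assms by (intro sum_nonpos) (simp add: mult_nonneg_nonpos)

text \<open>At the origin every monomial with nonzero exponent vanishes, while the one with exponent
  0 equals 1 because \<open>0 ^ 0 = 1\<close>. This identifies the zeroth coefficient of a power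
  series with its value at 0.\<close>

lemma mi_power_series_at_zero:
  fixes c :: "nat^'m \<Rightarrow> 'b::real_normed_vector"
  assumes "((\<lambda>\<alpha>. mi_power 0 \<alpha> *\<^sub>R c \<alpha>) has_sum l) UNIV"
  shows "l = c 0"
proof -
  have "((\<lambda>\<alpha>. mi_power 0 \<alpha> *\<^sub>R c \<alpha>) has_sum c 0) {0}"
    using has_sum_finite[of "{0}" "\<lambda>\<alpha>. mi_power 0 \<alpha> *\<^sub>R c \<alpha>"] by (simp add: mi_power_zero)
  then have "((\<lambda>\<alpha>. mi_power 0 \<alpha> *\<^sub>R c \<alpha>) has_sum c 0) UNIV"
    by (subst has_sum_cong_neutral[where T = "{0}"]) (auto simp: mi_power_zero)
  with assms show ?thesis
    using has_sum_unique by blast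
qed

lemma cauchy_prod_zero:
  fixes b c :: "nat^'m \<Rightarrow> real^'n^'n"
  shows "cauchy_prod b c 0 = b 0 ** c 0"
proof -
  have "{\<beta>. \<beta> \<le> (0 :: nat^'m)} = {0}"
    by (auto simp: less_eq_vec_def vec_eq_iff)
  moreover have "(0 :: nat^'m) - 0 = 0"
    by (simp add: vec_eq_iff)
  ultimately show ?thesis
    by (simp add: cauchy_prod_def)
qed

lemma cauchy_prod_split:
  assumes "\<alpha> \<noteq> 0"
  shows "cauchy_prod b c \<alpha> = b 0 ** c \<alpha> + b \<alpha> ** c 0 + cauchy_prod_hat b c \<alpha>"
proof -
  let ?f = "\<lambda>\<beta>. b (\<alpha> - \<beta>) ** c \<beta>"
  let ?H = "{\<beta>. \<beta> \<le> \<alpha> \<and> \<beta> \<noteq> 0 \<and> \<beta> \<noteq> \<alpha>}"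
  \<comment> \<open>The two extreme indices are distinct because \<alpha> is nonzero, so each
    contributes its own term.\<close>
  have "{\<beta>. \<beta> \<le> \<alpha>} = insert \<alpha> (insert 0 ?H)"
    by (auto simp: less_eq_vec_def)
  moreover have "finite ?H"
    using finite_subset[OF _ finite_mi_le[of \<alpha>]] by auto
  ultimately have "sum ?f {\<beta>. \<beta> \<le> \<alpha>} = ?f \<alpha> + (?f 0 + sum ?f ?H)"
    using assms by simp
  moreover have "\<alpha> - 0 = \<alpha>" "\<alpha> - \<alpha> = 0"
    by (simp_all add: vec_eq_iff)
  ultimately show ?thesis
    by (simp add: cauchy_prod_def cauchy_prod_hat_def)
qed

lemma diag_matrix_mult_nth: "(diag_matrix d ** M) $ i $ j = d i * M $ i $ j"
  by (simp add: diag_matrix_def matrix_matrix_mult_def if_distrib[of "\<lambda>x. x * _"] cong: if_cong)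

lemma mult_diag_matrix_nth: "(M ** diag_matrix d) $ i $ j = M $ i $ j * d j"
  by (simp add: diag_matrix_def matrix_matrix_mult_def if_distrib cong: if_cong)

lemma eigenvector_columns:
  assumes "\<And>j. J *v V j = \<mu> j *\<^sub>R V j"
  shows "J ** matrix_of_columns V = matrix_of_columns V ** diag_matrix \<mu>"
proof -
  have "(J ** matrix_of_columns V) $ i $ j = (J *v V j) $ i" for i j
    by (simp add: matrix_matrix_mult_def matrix_vector_mult_def matrix_of_columns_def)
  then show ?thesis
    by (simp add: vec_eq_iff mult_diag_matrix_nth assms matrix_of_columns_def)
qed

lemma matrix_mult_scaleR_right: "(M :: real^'n^'k) ** (r *\<^sub>R N) = r *\<^sub>R (M ** N)"
  by (simp add: vec_eq_iff matrix_matrix_mult_def sum_distrib_left mult_ac)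

text \<open>At a resonance, \<open>\<mu> i - \<mu> j\<close> is a nonnegative combination of stable
  eigenvalues, hence at most 0.\<close>

lemma Res_imp_le:
  fixes \<mu> :: "'n::linorder \<Rightarrow> real" and \<iota> :: "'m::finite \<Rightarrow> 'n"
  assumes "strict_mono \<mu>" and "\<And>k. \<mu> (\<iota> k) < 0" and "\<alpha> \<in> Res \<mu> \<iota> i j"
  shows "i \<le> j"
proof -
  have "\<mu> i - \<mu> j \<le> 0"
    using assms(3) mi_dot_nonpos[of "\<mu> \<circ> \<iota>" \<alpha>] assms(2)[THEN less_imp_le]
    by (simp add: Res_def)
  then show ?thesis
    using strict_mono_less_eq[OF assms(1)] by simp
qed

text \<open>A resonance writes \<open>\<mu> j - \<mu> i\<close> as a sum of nonnegative terms
  \<open>\<alpha> $ k * - \<mu> (\<iota> k)\<close>. Each term is at most the total, which bounds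
  every component of \<alpha>. Finiteness makes the \<open>Max\<close> in \<open>max_order\<close> a
  genuine upper bound.\<close>

lemma finite_Res:
  fixes \<iota> :: "'m::finite \<Rightarrow> 'n"
  assumes neg: "\<And>k. \<mu> (\<iota> k) < 0"
  shows "finite (Res \<mu> \<iota> i j)"
proof -
  \<comment> \<open>If \<open>\<mu> j < \<mu> i\<close>, then \<open>nat\<close> truncates the bound
    to 0; this is harmless, since there are no resonances then.\<close>
  let ?b = "\<chi> k. nat \<lceil>(\<mu> j - \<mu> i) / - \<mu> (\<iota> k)\<rceil>"
  have "\<alpha> \<le> ?b" if "\<alpha> \<in> Res \<mu> \<iota> i j" for \<alpha>
  proof -
    have "\<alpha> $ k \<le> ?b $ k" for k
    proof -
      have "real (\<alpha> $ k) * - \<mu> (\<iota> k) \<le> (\<Sum>k\<in>UNIV. real (\<alpha> $ k) * - \<mu> (\<iota> k))"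
        by (rule member_le_sum) (auto intro!: mult_nonneg_nonpos simp: neg less_imp_le)
      also have "\<dots> = \<mu> j - \<mu> i"
        using that by (simp add: Res_def mi_dot_def sum_negf)
      finally have "real (\<alpha> $ k) \<le> (\<mu> j - \<mu> i) / - \<mu> (\<iota> k)"
        using neg[of k] by (simp add: pos_le_divide_eq del: divide_minus_right)
      then show ?thesis
        by simp linarith
    qed
    then show ?thesis
      by (simp add: less_eq_vec_def)
  qed
  then show ?thesis
    using finite_subset[OF _ finite_mi_le[of ?b]] by blast
qed

lemma mi_order_le_max_order:
  assumes "finite R" and "\<alpha> \<in> R"
  shows "mi_order \<alpha> \<le> max_order R"
  using assms by (auto simp: max_order_def)

theorem lemma2p14:
  fixes G :: "real^'n::{finite,linorder} \<Rightarrow> real^'n::{finite,linorder}"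
    and Ustar :: "real^'n::{finite,linorder}"
    and \<mu> :: "'n::{finite,linorder} \<Rightarrow> real"
    and V :: "'n::{finite,linorder} \<Rightarrow> real^'n::{finite,linorder}"
    and \<iota> :: "'m::{finite,linorder} \<Rightarrow> 'n::{finite,linorder}"
    and P :: "real^'m::{finite,linorder} \<Rightarrow> real^'n::{finite,linorder}"
    and \<delta> :: real
    and Ghat W A S Wt St :: "nat^'m::{finite,linorder} \<Rightarrow> real^'n::{finite,linorder}^'n::{finite,linorder}"
  assumes G_analytic: "real_analytic_on G UNIV"
    and hyperbolic: "hyperbolic_equilibrium G Ustar"
    and eigenvalues_ordered: "strict_mono \<mu>"
    and stable_indices: "strict_mono \<iota>" "range \<iota> = {i. \<mu> i < 0}"
    and unstable_eigenvalues: "\<And>i. i \<notin> range \<iota> \<Longrightarrow> \<mu> i > 0"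
    and eigenvectors: "\<And>j. V j \<noteq> 0 \<and> jacobian G (at Ustar) *v V j = \<mu> j *\<^sub>R V j"
    and delta_pos: "\<delta> > 0"
    and P_analytic: "real_analytic_on P (cbox (vec (-\<delta>)) (vec \<delta>))"
    and P_stable_manifold: "local_stable_manifold G Ustar (P ` cbox (vec (-\<delta>)) (vec \<delta>))"
    and P_zero: "P 0 = Ustar"
    and DP_zero: "(P has_derivative (\<lambda>h. matrix_of_columns (V \<circ> \<iota>) *v h)) (at 0)"
    and P_conjugacy: "\<And>\<sigma> x. \<sigma> \<in> cbox (vec (-\<delta>)) (vec \<delta>) \<Longrightarrow> x \<ge> 0 \<Longrightarrow>
      flow_defined G x (P \<sigma>) \<and>
      flow G x (P \<sigma>) = P (diag_matrix (\<lambda>k. exp (\<mu> (\<iota> k) * x)) *v \<sigma>)"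
    and Ghat: "\<forall>\<^sub>F \<sigma> in nhds 0.
      ((\<lambda>\<alpha>. mi_power \<sigma> \<alpha> *\<^sub>R Ghat \<alpha>) has_sum jacobian G (at (P \<sigma>))) UNIV"
    and A_zero: "A 0 = diag_matrix \<mu>"
    and W_zero: "W 0 = matrix_of_columns V"
    and S_def: "\<And>\<alpha>. mi_order \<alpha> \<ge> 1 \<Longrightarrow>
      S \<alpha> = Ghat \<alpha> ** W 0 + cauchy_prod_hat Ghat W \<alpha> - cauchy_prod_hat W A \<alpha>"
    and W_tilde: "\<And>\<alpha>. mi_order \<alpha> \<ge> 1 \<Longrightarrow> W \<alpha> = W 0 ** Wt \<alpha>"
    and S_tilde: "\<And>\<alpha>. mi_order \<alpha> \<ge> 1 \<Longrightarrow> S \<alpha> = W 0 ** St \<alpha>"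
    and nonresonant: "\<And>\<alpha> i j. mi_order \<alpha> \<ge> 1 \<Longrightarrow> \<alpha> \<notin> Res \<mu> \<iota> i j \<Longrightarrow>
      Wt \<alpha> $ i $ j = St \<alpha> $ i $ j / (mi_dot \<alpha> (\<mu> \<circ> \<iota>) + \<mu> j - \<mu> i) \<and> A \<alpha> $ i $ j = 0"
    and resonant: "\<And>\<alpha> i j. mi_order \<alpha> \<ge> 1 \<Longrightarrow> \<alpha> \<in> Res \<mu> \<iota> i j \<Longrightarrow>
      Wt \<alpha> $ i $ j = 0 \<and> A \<alpha> $ i $ j = St \<alpha> $ i $ j"
  shows "(\<forall>\<alpha>. cauchy_prod Ghat W \<alpha> = mi_dot \<alpha> (\<mu> \<circ> \<iota>) *\<^sub>R W \<alpha> + cauchy_prod W A \<alpha>)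
    \<and> (\<forall>\<alpha> i j. i > j \<longrightarrow> A \<alpha> $ i $ j = 0)
    \<and> (\<forall>\<alpha> i j. mi_order \<alpha> > max_order (Res \<mu> \<iota> i j) \<longrightarrow> A \<alpha> $ i $ j = 0)"
proof -
  have neg: "\<mu> (\<iota> k) < 0" for k
    using stable_indices(2) by blast
  \<comment> \<open>A property that holds eventually in \<open>nhds 0\<close> holds at 0 itself, so
    the expansion may be evaluated there.\<close>
  have "Ghat 0 = jacobian G (at Ustar)"
    using mi_power_series_at_zero[OF eventually_nhds_x_imp_x[OF Ghat]] by (simp add: P_zero)
  then have intertwine: "Ghat 0 ** W 0 = W 0 ** diag_matrix \<mu>"
    using eigenvectors eigenvector_columns by (metis W_zero)
  have eq: "cauchy_prod Ghat W \<alpha> = mi_dot \<alpha> (\<mu> \<circ> \<iota>) *\<^sub>R W \<alpha> + cauchy_prod W A \<alpha>" for \<alpha>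
  proof (cases "\<alpha> = 0")
    case True
    then show ?thesis
      by (simp add: cauchy_prod_zero mi_dot_zero intertwine A_zero)
  next
    case False
    then have \<alpha>: "mi_order \<alpha> \<ge> 1"
      by (simp only: mi_order_ge_1_iff not_False_eq_True)
    let ?d = "mi_dot \<alpha> (\<mu> \<circ> \<iota>)"
    \<comment> \<open>This is the equation at order \<alpha> with the left factor \<open>W 0\<close>
      removed; the diagonal matrices decouple its entries.\<close>
    have "diag_matrix \<mu> ** Wt \<alpha> + St \<alpha> = ?d *\<^sub>R Wt \<alpha> + A \<alpha> + Wt \<alpha> ** diag_matrix \<mu>"
    proof -
      have "\<mu> i * Wt \<alpha> $ i $ j + St \<alpha> $ i $ j = ?d * Wt \<alpha> $ i $ j + A \<alpha> $ i $ j + Wt \<alpha> $ i $ j * \<mu> j"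
        for i j
      proof (cases "\<alpha> \<in> Res \<mu> \<iota> i j")
        case True
        then show ?thesis
          using resonant[OF \<alpha>] by simp
      next
        case False
        then have "?d + \<mu> j - \<mu> i \<noteq> 0"
          using \<alpha> by (simp add: Res_def)
        then have "(?d + \<mu> j - \<mu> i) * Wt \<alpha> $ i $ j = St \<alpha> $ i $ j" "A \<alpha> $ i $ j = 0"
          using nonresonant[OF \<alpha> False] by simp_all
        then show ?thesis
          by (simp add: algebra_simps)
      qed
      then show ?thesis
        by (simp add: vec_eq_iff diag_matrix_mult_nth mult_diag_matrix_nth)
    qed
    then have "W 0 ** (diag_matrix \<mu> ** Wt \<alpha> + St \<alpha>)
        = W 0 ** (?d *\<^sub>R Wt \<alpha> + A \<alpha> + Wt \<alpha> ** diag_matrix \<mu>)"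
      by simp
    \<comment> \<open>By \<open>intertwine\<close>,
      \<open>W 0 ** diag_matrix \<mu> ** Wt \<alpha>\<close> is
      \<open>Ghat 0 ** W 0 ** Wt \<alpha>\<close>, that is,
      \<open>Ghat 0 ** W \<alpha>\<close>.\<close>
    then have "Ghat 0 ** W \<alpha> + S \<alpha> = ?d *\<^sub>R W \<alpha> + W 0 ** A \<alpha> + W \<alpha> ** A 0"
      by (simp add: W_tilde[OF \<alpha>] S_tilde[OF \<alpha>] A_zero matrix_add_ldistrib matrix_mul_assoc
          matrix_mult_scaleR_right intertwine)
    \<comment> \<open>Expanding \<open>S \<alpha>\<close> supplies
      \<open>Ghat \<alpha> ** W 0\<close> and both reduced products, which are exactly the terms
      still missing from the two full Cauchy products.\<close>
    then show ?thesis
      by (simp add: cauchy_prod_split[OF False] S_def[OF \<alpha>] algebra_simps)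
  qed
  have upper: "A \<alpha> $ i $ j = 0" if "i > j" for \<alpha> i j
  proof (cases "\<alpha> = 0")
    case True
    with that show ?thesis
      by (simp add: A_zero diag_matrix_def)
  next
    case False
    moreover have "\<alpha> \<notin> Res \<mu> \<iota> i j"
      using Res_imp_le[of \<mu> \<iota>, OF eigenvalues_ordered neg] that by (meson not_le)
    ultimately show ?thesis
      using nonresonant mi_order_ge_1_iff by blast
  qed
  have "A \<alpha> $ i $ j = 0" if "mi_order \<alpha> > max_order (Res \<mu> \<iota> i j)" for \<alpha> i j
  proof -
    have "\<alpha> \<notin> Res \<mu> \<iota> i j"
      using mi_order_le_max_order[OF finite_Res[of \<mu> \<iota>, OF neg]] that by (meson not_le)
    \<comment> \<open>The strict inequality excludes order 0 even when there are no resonances and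
      the maximum is 0 by convention; \<open>A 0\<close> has the nonzero eigenvalues on its
      diagonal.\<close>
    moreover have "mi_order \<alpha> \<ge> 1"
      using that by simp
    ultimately show ?thesis
      using nonresonant by blast
  qed
  with eq upper show ?thesis
    by blast
qed

end
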